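(* Let $G$ be a finite triangle-free graph. Then $\gamma(G)=\gamma_{\mathrm{m}}^{\infty}(G)=2$ if and only if $G=C_5$ (the $5$-cycle) or $G\in\mathfrak{C}$, where $\mathfrak{C}$ is the class of all graphs obtained either from $K_{m,m}$, $m\geq 2$, by deleting (the edges of) a matching of size $k$, where $0\leq k\leq m$, or from $K_{m,n}$, $n>m\geq 2$, by deleting (the edges of) a matching of size $\ell$, where $0\leq \ell\leq m-1$.
   Context: All graphs are finite, simple and undirected, and equality of graphs means isomorphism. A dominating set of $G=(V,E)$ is a set $D\subseteq V$ such that every vertex of $V-D$ is adjacent to a vertex of $D$; $\gamma(G)$ is the minimum size of a dominating set. m-eternal domination ("all guards move"): a defender chooses a set $D_1\subseteq V$ and places one guard on each vertex of $D_1$. Then, for $i=1,2,\ldots$ in turn, an attacker (knowing the current position) chooses a vertex $r_i\in V-D_i$, and the defender responds with a set $D_{i+1}$ with $|D_{i+1}|=|D_i|$ and $r_i\in D_{i+1}$, obtained from $D_i$ by letting each guard either stay in place or move to an adjacent vertex (i.e. there is a bijection $f:D_i\to D_{i+1}$ with $f(v)=v$ or $f(v)$ adjacent to $v$ for each $v\in D_i$). Every $D_i$ must be a dominating set. $D_1$ is an m-eternal dominating set if the defender, starting from $D_1$, can respond in this way forever to every infinite sequence of attacks. $\gamma_{\mathrm{m}}^{\infty}(G)$ is the minimum size of an m-eternal dominating set of $G$.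
   Formalization: The formal theorem excludes two graphs, 2K_1 (two isolated vertices) and K_1 ∪ K_2: both are triangle-free with both parameters equal to 2, yet have fewer than four vertices, so they are neither C_5 nor in the class and the claim as stated fails for them. *)

theory Defs
  imports Main
begin

section \<open>Finite simple graphs\<close>

text \<open>A graph is given by a vertex set and a set of edges, the edges being two-element sets of
  vertices; in a simple graph distinctness of adjacent vertices is therefore automatic.\<close>

definition simple_graph :: "'a set \<Rightarrow> 'a set set \<Rightarrow> bool" where
  "simple_graph V E \<longleftrightarrow> finite V \<and> (\<forall>e\<in>E. e \<subseteq> V \<and> card e = 2)"

definition triangle_free :: "'a set set \<Rightarrow> bool" where
  "triangle_free E \<longleftrightarrow> \<not> (\<exists>u v w. {u, v} \<in> E \<and> {v, w} \<in> E \<and> {u, w} \<in> E)"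

definition graph_iso :: "'a set \<Rightarrow> 'a set set \<Rightarrow> 'b set \<Rightarrow> 'b set set \<Rightarrow> bool" where
  "graph_iso V E V' E' \<longleftrightarrow>
     (\<exists>f. bij_betw f V V' \<and> (\<forall>u\<in>V. \<forall>v\<in>V. {u, v} \<in> E \<longleftrightarrow> {f u, f v} \<in> E'))"

definition cycle_verts :: "nat \<Rightarrow> nat set" where
  "cycle_verts n = {..<n}"

definition cycle_edges :: "nat \<Rightarrow> nat set set" where
  "cycle_edges n = {{i, (i + 1) mod n} | i. i < n}"

definition complete_bipartite_verts :: "nat \<Rightarrow> nat \<Rightarrow> (nat + nat) set" where
  "complete_bipartite_verts m n = {..<m} <+> {..<n}"

definition complete_bipartite_edges :: "nat \<Rightarrow> nat \<Rightarrow> (nat + nat) set set" where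
  "complete_bipartite_edges m n = {{Inl i, Inr j} | i j. i < m \<and> j < n}"

definition matching :: "'a set set \<Rightarrow> 'a set set \<Rightarrow> bool" where
  "matching E M \<longleftrightarrow> M \<subseteq> E \<and> (\<forall>e\<in>M. \<forall>e'\<in>M. e \<noteq> e' \<longrightarrow> e \<inter> e' = {})"

definition bipartite_minus_matching :: "nat \<Rightarrow> nat \<Rightarrow> nat \<Rightarrow> 'a set \<Rightarrow> 'a set set \<Rightarrow> bool" where
  "bipartite_minus_matching m n k V E \<longleftrightarrow>
     (\<exists>M. matching (complete_bipartite_edges m n) M \<and> card M = k \<and>
          graph_iso V E (complete_bipartite_verts m n) (complete_bipartite_edges m n - M))"

definition class_C :: "'a set \<Rightarrow> 'a set set \<Rightarrow> bool" where
  "class_C V E \<longleftrightarrow>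
     (\<exists>m k. m \<ge> 2 \<and> k \<le> m \<and> bipartite_minus_matching m m k V E) \<or>
     (\<exists>m n l. n > m \<and> m \<ge> 2 \<and> l \<le> m - 1 \<and> bipartite_minus_matching m n l V E)"


section \<open>Domination\<close>

definition dominating_set :: "'a set \<Rightarrow> 'a set set \<Rightarrow> 'a set \<Rightarrow> bool" where
  "dominating_set V E D \<longleftrightarrow> D \<subseteq> V \<and> (\<forall>v\<in>V - D. \<exists>d\<in>D. {v, d} \<in> E)"

definition domination_number :: "'a set \<Rightarrow> 'a set set \<Rightarrow> nat" where
  "domination_number V E = (LEAST k. \<exists>D. dominating_set V E D \<and> card D = k)"


section \<open>m-eternal domination\<close>

definition guards_move :: "'a set set \<Rightarrow> 'a set \<Rightarrow> 'a set \<Rightarrow> bool" where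
  "guards_move E D D' \<longleftrightarrow> (\<exists>f. bij_betw f D D' \<and> (\<forall>v\<in>D. f v = v \<or> {v, f v} \<in> E))"

text \<open>A strategy \<open>\<sigma>\<close> of the defender assigns to the list of attacks made so far (oldest first) the
  resulting guard set, so that the defender never sees future attacks; the attacker may choose
  each attack depending on the current guard set.\<close>

definition legal_attacks :: "'a set \<Rightarrow> ('a list \<Rightarrow> 'a set) \<Rightarrow> 'a list \<Rightarrow> bool" where
  "legal_attacks V \<sigma> rs \<longleftrightarrow> (\<forall>i<length rs. rs ! i \<in> V - \<sigma> (take i rs))"

text \<open>Winning against every infinite attack sequence is expressed through its finite prefixes:
  after each legal attack the response must be a legal one. Quantifying only over
  infinite sequences that are legal against \<open>\<sigma>\<close> would be wrong, as an illegal response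
  occupying all of \<open>V\<close> would leave no such sequence.\<close>

definition winning_strategy :: "'a set \<Rightarrow> 'a set set \<Rightarrow> ('a list \<Rightarrow> 'a set) \<Rightarrow> bool" where
  "winning_strategy V E \<sigma> \<longleftrightarrow>
     dominating_set V E (\<sigma> []) \<and>
     (\<forall>rs r. legal_attacks V \<sigma> (rs @ [r]) \<longrightarrow>
        r \<in> \<sigma> (rs @ [r]) \<and> guards_move E (\<sigma> rs) (\<sigma> (rs @ [r])) \<and>
        dominating_set V E (\<sigma> (rs @ [r])))"

definition m_eternal_dominating_set :: "'a set \<Rightarrow> 'a set set \<Rightarrow> 'a set \<Rightarrow> bool" where
  "m_eternal_dominating_set V E D \<longleftrightarrow> (\<exists>\<sigma>. \<sigma> [] = D \<and> winning_strategy V E \<sigma>)"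

definition m_eternal_domination_number :: "'a set \<Rightarrow> 'a set set \<Rightarrow> nat" where
  "m_eternal_domination_number V E = (LEAST k. \<exists>D. m_eternal_dominating_set V E D \<and> card D = k)"


section \<open>Two degenerate graphs\<close>

text \<open>The graphs \<open>2K\<^sub>1\<close> and \<open>K\<^sub>1 \<union> K\<^sub>2\<close> (that is, \<open>K\<^sub>1\<^sub>,\<^sub>1\<close> and \<open>K\<^sub>1\<^sub>,\<^sub>2\<close> minus one edge) are triangle-free with
  both parameters equal to 2, but have fewer than four vertices and so are neither \<open>C\<^sub>5\<close> nor in
  the class, which requires \<open>m \<ge> 2\<close>. The characterization has to exclude them;
  see \<open>two_K1_degenerate\<close> and \<open>K1_union_K2_degenerate\<close> below.\<close>

definition two_K1 :: "'a set \<Rightarrow> 'a set set \<Rightarrow> bool" where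
  "two_K1 V E \<longleftrightarrow> graph_iso V E {0, 1 :: nat} {}"

definition K1_union_K2 :: "'a set \<Rightarrow> 'a set set \<Rightarrow> bool" where
  "K1_union_K2 V E \<longleftrightarrow> graph_iso V E {0, 1, 2 :: nat} {{1, 2}}"

lemma both_numbers_eq_2:
  assumes D: "m_eternal_dominating_set V E D" "card D = 2"
    and min: "\<And>D. dominating_set V E D \<Longrightarrow> card D \<ge> 2"
  shows "domination_number V E = 2 \<and> m_eternal_domination_number V E = 2"
proof -
  have dom: "dominating_set V E D" if "m_eternal_dominating_set V E D" for D
    using that by (auto simp: m_eternal_dominating_set_def winning_strategy_def)
  have "domination_number V E = 2"
    unfolding domination_number_def using D min dom by (intro Least_equality) auto
  moreover have "m_eternal_domination_number V E = 2"
    unfolding m_eternal_domination_number_def using D min dom by (intro Least_equality) auto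
  ultimately show ?thesis ..
qed

lemma not_C5_or_class_C:
  assumes "card V < 4"
  shows "\<not> (graph_iso V E (cycle_verts 5) (cycle_edges 5) \<or> class_C V E)"
proof -
  have "card V = 5" if "graph_iso V E (cycle_verts 5) (cycle_edges 5)"
    using that by (auto simp: graph_iso_def cycle_verts_def dest: bij_betw_same_card)
  moreover have "card V = m + n" if "bipartite_minus_matching m n k V E" for m n k
    using that
    by (auto simp: bipartite_minus_matching_def graph_iso_def complete_bipartite_verts_def
        card_Plus dest!: bij_betw_same_card)
  ultimately show ?thesis
    using assms unfolding class_C_def by fastforce
qed

lemma legal_attacks_last:
  assumes "legal_attacks V \<sigma> (rs @ [r])"
  shows "r \<in> V - \<sigma> rs"
proof -
  have "(rs @ [r]) ! length rs \<in> V - \<sigma> (take (length rs) (rs @ [r]))"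
    using assms unfolding legal_attacks_def by (metis length_append_singleton lessI)
  then show ?thesis by simp
qed

lemma two_K1_degenerate:
  fixes V :: "nat set"
  defines "V \<equiv> {0, 1}" and "E \<equiv> {}"
  shows "simple_graph V E" "triangle_free E"
    "domination_number V E = 2 \<and> m_eternal_domination_number V E = 2"
    "\<not> (graph_iso V E (cycle_verts 5) (cycle_edges 5) \<or> class_C V E)"
proof -
  show "simple_graph V E" "triangle_free E"
    by (auto simp: simple_graph_def triangle_free_def V_def E_def)
  show "\<not> (graph_iso V E (cycle_verts 5) (cycle_edges 5) \<or> class_C V E)"
    by (rule not_C5_or_class_C) (simp add: V_def)
  have "winning_strategy V E (\<lambda>_. V)"
    using legal_attacks_last[of V "\<lambda>_. V"]
    by (auto simp: winning_strategy_def dominating_set_def)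
  then have "m_eternal_dominating_set V E V"
    unfolding m_eternal_dominating_set_def by (intro exI[of _ "\<lambda>_. V"]) simp
  moreover have "card D \<ge> 2" if "dominating_set V E D" for D
  proof -
    have "D = V"
      using that by (auto simp: dominating_set_def V_def E_def)
    then show ?thesis by (simp add: V_def)
  qed
  ultimately show "domination_number V E = 2 \<and> m_eternal_domination_number V E = 2"
    by (intro both_numbers_eq_2[of V E V]) (simp_all add: V_def)
qed

lemma K1_union_K2_degenerate:
  fixes V :: "nat set"
  defines "V \<equiv> {0, 1, 2}" and "E \<equiv> {{1, 2}}"
  shows "simple_graph V E" "triangle_free E"
    "domination_number V E = 2 \<and> m_eternal_domination_number V E = 2"
    "\<not> (graph_iso V E (cycle_verts 5) (cycle_edges 5) \<or> class_C V E)"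
proof -
  show "simple_graph V E"
    by (simp add: simple_graph_def V_def E_def)
  show "triangle_free E"
    unfolding triangle_free_def E_def singleton_iff doubleton_eq_iff by presburger
  show "\<not> (graph_iso V E (cycle_verts 5) (cycle_edges 5) \<or> class_C V E)"
    by (rule not_C5_or_class_C) (simp add: V_def)
  define \<sigma> :: "nat list \<Rightarrow> nat set"
    where "\<sigma> rs = (if rs \<noteq> [] \<and> last rs = 2 then {0, 2} else {0, 1})" for rs
  have dom: "dominating_set V E (\<sigma> rs)" for rs
    by (auto simp: dominating_set_def V_def E_def \<sigma>_def insert_commute)
  have "r \<in> \<sigma> (rs @ [r]) \<and> guards_move E (\<sigma> rs) (\<sigma> (rs @ [r]))"
    if "legal_attacks V \<sigma> (rs @ [r])" for rs r
  proof -
    have r: "r \<in> V - \<sigma> rs"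
      using that by (rule legal_attacks_last)
    have "guards_move E {0, 1} {0, 2}"
      unfolding guards_move_def E_def
      by (rule exI[of _ "id(1 := 2)"]) (auto simp: bij_betw_def)
    moreover have "guards_move E {0, 2} {0, 1}"
      unfolding guards_move_def E_def
      by (rule exI[of _ "id(2 := 1)"]) (auto simp: bij_betw_def)
    ultimately show ?thesis
      using r by (auto simp: V_def \<sigma>_def split: if_splits)
  qed
  then have "winning_strategy V E \<sigma>"
    using dom by (auto simp: winning_strategy_def)
  moreover have "\<sigma> [] = {0, 1}" by (simp add: \<sigma>_def)
  ultimately have "m_eternal_dominating_set V E {0, 1}"
    unfolding m_eternal_dominating_set_def by (intro exI[of _ \<sigma>]) simp
  moreover have "card D \<ge> 2" if "dominating_set V E D" for D
  proof -
    have "0 \<in> D" "1 \<in> D \<or> 2 \<in> D" "finite D"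
      using that by (auto simp: dominating_set_def V_def E_def doubleton_eq_iff intro: finite_subset)
    then obtain x where "{0, x} \<subseteq> D" "x \<noteq> 0" by auto
    then show ?thesis
      using \<open>finite D\<close> card_mono[of D "{0, x}"] by simp
  qed
  ultimately show "domination_number V E = 2 \<and> m_eternal_domination_number V E = 2"
    by (intro both_numbers_eq_2[of V E "{0, 1}"]) auto
qed

end

theory Submission
  imports Defs
begin

text \<open>For the forward direction, consider an eternal pair \<open>{x, y}\<close>. If \<open>x\<close> and \<open>y\<close> are adjacent,
  triangle-freeness makes \<open>N(x)\<close> and \<open>N(y)\<close> independent, so the graph is bipartite; since every
  vertex lies in a dominating pair, each vertex misses at most one vertex of the other side. If no
  eternal pair is adjacent but \<open>x\<close> and \<open>y\<close> have a common neighbour \<open>c\<close>, the response to an attack on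
  \<open>c\<close> leaves only \<open>C\<^sub>4\<close>, \<open>P\<^sub>4\<close> and \<open>C\<^sub>5\<close>. Otherwise each vertex is non-adjacent to exactly its
  partner on the other side, so a perfect matching has been deleted.
  Conversely, in a graph of the class the pairs that are matched, or both unmatched, are dominating
  and any attack leads from one such pair to another, as do the attacks on pairs of vertices at
  distance two in \<open>C\<^sub>5\<close>.\<close>

section \<open>Eternal domination and closed families of guard sets\<close>

text \<open>The game unrolls by one round: following \<open>\<sigma>\<close> on histories that begin
  with \<open>r\<close> is a winning strategy from the position reached after the attack on
  \<open>r\<close>. In the locale \<open>two_guards\<close>, strategies enter only through this
  lemma and \<open>m_eternal_dominating\<close>.\<close>

lemma m_eternal_step:
  assumes "m_eternal_dominating_set V E D" and "r \<in> V - D"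
  shows "\<exists>D'. r \<in> D' \<and> guards_move E D D' \<and> m_eternal_dominating_set V E D'"
proof -
  obtain \<sigma> where \<sigma>: "\<sigma> [] = D" "winning_strategy V E \<sigma>"
    using assms(1) unfolding m_eternal_dominating_set_def by blast
  \<comment> \<open>Legality transfers from the shifted strategy to \<open>\<sigma>\<close>; the
    extra attack at index 0 is legal because \<open>r\<close> lies outside \<open>D\<close>.\<close>
  have legal: "legal_attacks V \<sigma> (r # rs)" if "legal_attacks V (\<lambda>rs. \<sigma> (r # rs)) rs" for rs
    unfolding legal_attacks_def
  proof (intro allI impI)
    fix i assume "i < length (r # rs)"
    then show "(r # rs) ! i \<in> V - \<sigma> (take i (r # rs))"
      using that assms(2) \<sigma>(1) by (cases i) (auto simp: legal_attacks_def)
  qed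
  have first: "legal_attacks V \<sigma> ([] @ [r])"
    using legal[of "[]"] by (simp add: legal_attacks_def)
  have response: "r \<in> \<sigma> [r] \<and> guards_move E D (\<sigma> [r]) \<and> dominating_set V E (\<sigma> [r])"
    using \<sigma>(2)[unfolded winning_strategy_def, THEN conjunct2, rule_format, OF first] \<sigma>(1) by simp
  have "winning_strategy V E (\<lambda>rs. \<sigma> (r # rs))"
    unfolding winning_strategy_def
  proof (intro conjI allI impI)
    show "dominating_set V E (\<sigma> (r # []))"
      using response by blast
  next
    fix rs s assume "legal_attacks V (\<lambda>rs. \<sigma> (r # rs)) (rs @ [s])"
    then have "legal_attacks V \<sigma> ((r # rs) @ [s])" using legal by simp
    then have "s \<in> \<sigma> ((r # rs) @ [s]) \<and> guards_move E (\<sigma> (r # rs)) (\<sigma> ((r # rs) @ [s])) \<and>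
        dominating_set V E (\<sigma> ((r # rs) @ [s]))"
      using \<sigma>(2) unfolding winning_strategy_def by blast
    then show "s \<in> \<sigma> (r # (rs @ [s]))" "guards_move E (\<sigma> (r # rs)) (\<sigma> (r # (rs @ [s])))"
      "dominating_set V E (\<sigma> (r # (rs @ [s])))"
      by simp_all
  qed
  then have "m_eternal_dominating_set V E (\<sigma> [r])"
    unfolding m_eternal_dominating_set_def by (intro exI[of _ "\<lambda>rs. \<sigma> (r # rs)"]) simp
  then show ?thesis using response by blast
qed

text \<open>If every attack on a member of \<open>F\<close> can be answered inside \<open>F\<close>,
  one response can be fixed per position and attack. The resulting strategy depends on the history
  only through the current guard set.\<close>

lemma m_eternal_if_closed_family:
  assumes dom: "\<And>D. D \<in> F \<Longrightarrow> dominating_set V E D"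
    and step: "\<And>D r. D \<in> F \<Longrightarrow> r \<in> V - D \<Longrightarrow> \<exists>D'\<in>F. r \<in> D' \<and> guards_move E D D'"
    and "D \<in> F"
  shows "m_eternal_dominating_set V E D"
proof -
  define next_set where "next_set D r = (SOME D'. D' \<in> F \<and> r \<in> D' \<and> guards_move E D D')" for D r
  have next_set: "next_set D r \<in> F \<and> r \<in> next_set D r \<and> guards_move E D (next_set D r)"
    if "D \<in> F" "r \<in> V - D" for D r
    unfolding next_set_def by (rule someI_ex) (use step[OF that] in blast)
  \<comment> \<open>Folding along the list of attacks turns the choice of responses to positions
    into a strategy on histories.\<close>
  define \<sigma> where "\<sigma> = foldl next_set D"
  have \<sigma>_snoc: "\<sigma> (rs @ [r]) = next_set (\<sigma> rs) r" for rs r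
    by (simp add: \<sigma>_def)
  have legal_prefix: "legal_attacks V \<sigma> rs" if "legal_attacks V \<sigma> (rs @ [r])" for rs r
    unfolding legal_attacks_def
  proof (intro allI impI)
    fix i assume "i < length rs"
    then show "rs ! i \<in> V - \<sigma> (take i rs)"
      using that[unfolded legal_attacks_def, rule_format, of i] by (simp add: nth_append)
  qed
  \<comment> \<open>\<open>next_set\<close> is controlled only for attacks outside the current set,
    so the invariant is restricted to legal histories.\<close>
  have in_F: "\<sigma> rs \<in> F" if "legal_attacks V \<sigma> rs" for rs
    using that
  proof (induction rs rule: rev_induct)
    case Nil
    then show ?case using \<open>D \<in> F\<close> by (simp add: \<sigma>_def)
  next
    case (snoc r rs)
    then show ?case
      using next_set legal_prefix legal_attacks_last by (metis \<sigma>_snoc)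
  qed
  have "winning_strategy V E \<sigma>"
    unfolding winning_strategy_def
  proof (intro conjI allI impI)
    show "dominating_set V E (\<sigma> [])" using dom \<open>D \<in> F\<close> by (simp add: \<sigma>_def)
  next
    fix rs r assume legal: "legal_attacks V \<sigma> (rs @ [r])"
    then have "\<sigma> rs \<in> F" "r \<in> V - \<sigma> rs"
      by (rule in_F[OF legal_prefix], rule legal_attacks_last)
    then show "r \<in> \<sigma> (rs @ [r])" "guards_move E (\<sigma> rs) (\<sigma> (rs @ [r]))"
      using next_set by (simp_all add: \<sigma>_snoc)
    show "dominating_set V E (\<sigma> (rs @ [r]))" by (rule dom[OF in_F[OF legal]])
  qed
  then show ?thesis
    unfolding m_eternal_dominating_set_def by (intro exI[of _ \<sigma>]) (simp add: \<sigma>_def)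
qed

text \<open>With a guard on every vertex no attack is possible. This ensures that the minimum
  defining the eternal domination number is attained.\<close>

lemma m_eternal_UNIV: "m_eternal_dominating_set V E V"
  by (rule m_eternal_if_closed_family[of "{V}"]) (auto simp: dominating_set_def)

lemma m_eternal_dominating:
  "m_eternal_dominating_set V E D \<Longrightarrow> dominating_set V E D"
  by (auto simp: m_eternal_dominating_set_def winning_strategy_def)

section \<open>Moves of two guards and a lower bound for dominating sets\<close>

lemma guards_move_pairI:
  assumes "a \<noteq> b" "a' \<noteq> b'" "a = a' \<or> {a, a'} \<in> E" "b = b' \<or> {b, b'} \<in> E"
  shows "guards_move E {a, b} {a', b'}"
  unfolding guards_move_def using assms
  by (intro exI[of _ "(\<lambda>_. a')(b := b')"]) (auto simp: bij_betw_def inj_on_def)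

lemma guards_move_pairE:
  assumes "guards_move E {x, y} {c, z}" "x \<noteq> y" "c \<noteq> z"
  shows "((x = c \<or> {x, c} \<in> E) \<and> (y = z \<or> {y, z} \<in> E)) \<or>
         ((y = c \<or> {y, c} \<in> E) \<and> (x = z \<or> {x, z} \<in> E))"
proof -
  obtain f where f: "bij_betw f {x, y} {c, z}" "\<forall>v\<in>{x, y}. f v = v \<or> {v, f v} \<in> E"
    using assms(1) unfolding guards_move_def by blast
  have "{f x, f y} = {c, z}" using f(1) by (auto simp: bij_betw_def)
  then show ?thesis using f(2) by (auto simp: doubleton_eq_iff)
qed

lemma card_dominating_ge_2:
  assumes "finite V" "V \<noteq> {}" and "\<And>v. v \<in> V \<Longrightarrow> \<exists>u\<in>V. u \<noteq> v \<and> {u, v} \<notin> E"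
    and "dominating_set V E D"
  shows "card D \<ge> 2"
proof (rule ccontr)
  assume "\<not> card D \<ge> 2"
  moreover have "finite D" using assms(1,4) by (auto simp: dominating_set_def intro: finite_subset)
  ultimately have "D = {} \<or> (\<exists>v. D = {v})"
    by (metis card_0_eq card_1_singletonE less_2_cases not_le One_nat_def)
  then show False using assms(2-4) unfolding dominating_set_def by fastforce
qed

section \<open>Nearly complete bipartite graphs\<close>

text \<open>The last condition says that both sides or neither side contains a vertex missed by the
  deleted matching; it captures the bounds on the size of the matching in the definition of the
  class without referring to sizes.\<close>

definition nearly_complete :: "'a set \<Rightarrow> 'a set set \<Rightarrow> 'a set \<Rightarrow> 'a set \<Rightarrow> bool" where
  "nearly_complete V E A B \<longleftrightarrow>
     V = A \<union> B \<and> A \<inter> B = {} \<and> 2 \<le> card A \<and> 2 \<le> card B \<and>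
     (\<forall>u v. {u, v} \<in> E \<longrightarrow> u \<in> A \<and> v \<in> B \<or> u \<in> B \<and> v \<in> A) \<and>
     (\<forall>a\<in>A. \<forall>b\<in>B. \<forall>b'\<in>B. {a, b} \<notin> E \<and> {a, b'} \<notin> E \<longrightarrow> b = b') \<and>
     (\<forall>b\<in>B. \<forall>a\<in>A. \<forall>a'\<in>A. {a, b} \<notin> E \<and> {a', b} \<notin> E \<longrightarrow> a = a') \<and>
     ((\<exists>a\<in>A. \<forall>b\<in>B. {a, b} \<in> E) \<longleftrightarrow> (\<exists>b\<in>B. \<forall>a\<in>A. {a, b} \<in> E))"

lemma nearly_completeD:
  assumes "nearly_complete V E A B"
  shows "V = A \<union> B" "A \<inter> B = {}" "2 \<le> card A" "2 \<le> card B"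
    and "\<And>u v. {u, v} \<in> E \<Longrightarrow> u \<in> A \<and> v \<in> B \<or> u \<in> B \<and> v \<in> A"
    and "\<And>a b b'. a \<in> A \<Longrightarrow> b \<in> B \<Longrightarrow> b' \<in> B \<Longrightarrow> {a, b} \<notin> E \<Longrightarrow> {a, b'} \<notin> E \<Longrightarrow> b = b'"
    and "\<And>a a' b. b \<in> B \<Longrightarrow> a \<in> A \<Longrightarrow> a' \<in> A \<Longrightarrow> {a, b} \<notin> E \<Longrightarrow> {a', b} \<notin> E \<Longrightarrow> a = a'"
    and "(\<exists>a\<in>A. \<forall>b\<in>B. {a, b} \<in> E) \<longleftrightarrow> (\<exists>b\<in>B. \<forall>a\<in>A. {a, b} \<in> E)"
  using assms unfolding nearly_complete_def by simp_all

lemma nearly_completeI: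
  assumes "V = A \<union> B" "A \<inter> B = {}" "2 \<le> card A" "2 \<le> card B"
    and "\<And>u v. {u, v} \<in> E \<Longrightarrow> u \<in> A \<and> v \<in> B \<or> u \<in> B \<and> v \<in> A"
    and "\<And>a b b'. a \<in> A \<Longrightarrow> b \<in> B \<Longrightarrow> b' \<in> B \<Longrightarrow> {a, b} \<notin> E \<Longrightarrow> {a, b'} \<notin> E \<Longrightarrow> b = b'"
    and "\<And>a a' b. b \<in> B \<Longrightarrow> a \<in> A \<Longrightarrow> a' \<in> A \<Longrightarrow> {a, b} \<notin> E \<Longrightarrow> {a', b} \<notin> E \<Longrightarrow> a = a'"
    and "(\<exists>a\<in>A. \<forall>b\<in>B. {a, b} \<in> E) \<longleftrightarrow> (\<exists>b\<in>B. \<forall>a\<in>A. {a, b} \<in> E)"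
  shows "nearly_complete V E A B"
  unfolding nearly_complete_def
  by (intro conjI allI ballI impI) (rule assms; (assumption | erule conjunct1 | erule conjunct2))+

lemma nearly_complete_sym:
  assumes nc: "nearly_complete V E A B"
  shows "nearly_complete V E B A"
proof (rule nearly_completeI)
  show "V = B \<union> A" "B \<inter> A = {}" using nearly_completeD(1,2)[OF nc] by auto
  show "2 \<le> card A" "2 \<le> card B" by (fact nearly_completeD[OF nc])+
  show "u \<in> B \<and> v \<in> A \<or> u \<in> A \<and> v \<in> B" if "{u, v} \<in> E" for u v
    using nearly_completeD(5)[OF nc that] by blast
  show "a = a'" if "b \<in> B" "a \<in> A" "a' \<in> A" "{b, a} \<notin> E" "{b, a'} \<notin> E" for b a a'
    using nearly_completeD(7)[OF nc] that by (metis insert_commute)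
  show "b = b'" if "a \<in> A" "b \<in> B" "b' \<in> B" "{b, a} \<notin> E" "{b', a} \<notin> E" for a b b'
    using nearly_completeD(6)[OF nc] that by (metis insert_commute)
  show "(\<exists>b\<in>B. \<forall>a\<in>A. {b, a} \<in> E) \<longleftrightarrow> (\<exists>a\<in>A. \<forall>b\<in>B. {b, a} \<in> E)"
    using nearly_completeD(8)[OF nc] by (simp add: insert_commute)
qed

lemma obtains_other:
  assumes "2 \<le> card A" obtains b where "b \<in> A" "b \<noteq> a"
proof -
  have "\<not> A \<subseteq> {a}" using assms card_mono[of "{a}" A] by fastforce
  then show ?thesis using that by blast
qed

text \<open>A vertex missed by \<open>a\<close> serves as \<open>b\<close>, since non-neighbours
  across the bipartition are unique. If \<open>a\<close> misses nothing, the last condition of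
  \<open>nearly_complete\<close> supplies a vertex \<open>b\<close> that misses nothing
  either.\<close>

lemma nearly_complete_partner:
  assumes nc: "nearly_complete V E A B" and "a \<in> A"
  obtains b where "b \<in> B" "\<And>b'. b' \<in> B \<Longrightarrow> b' \<noteq> b \<Longrightarrow> {a, b'} \<in> E"
    "\<And>a'. a' \<in> A \<Longrightarrow> a' \<noteq> a \<Longrightarrow> {a', b} \<in> E"
proof (cases "\<exists>b\<in>B. {a, b} \<notin> E")
  case True
  then obtain b where "b \<in> B" "{a, b} \<notin> E" by blast
  then show ?thesis
    using nearly_completeD(6,7)[OF nc] \<open>a \<in> A\<close> by (intro that[of b]) blast+
next
  case False
  then obtain b where "b \<in> B" "\<forall>a\<in>A. {a, b} \<in> E"
    using nearly_completeD(8)[OF nc] \<open>a \<in> A\<close> by blast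
  then show ?thesis using False by (intro that[of b]) blast+
qed

section \<open>The two parameters of nearly complete bipartite graphs\<close>

text \<open>The pairs of \<open>nearly_complete_partner\<close> form a closed family: when
  \<open>u\<close> on the side of \<open>a\<close> is attacked, guard \<open>b\<close> moves to
  \<open>u\<close> and guard \<open>a\<close> moves to a partner of \<open>u\<close>. Fewer than two
  guards fail because each side is independent and has at least two vertices.\<close>

lemma nearly_complete_numbers:
  assumes nc: "nearly_complete V E A B" and "finite V"
  shows "domination_number V E = 2 \<and> m_eternal_domination_number V E = 2"
proof -
  \<comment> \<open>The sides are parameters of \<open>safe\<close>, so that attacks on
    \<open>B\<close> reduce to attacks on \<open>A\<close> by exchanging the sides.\<close>
  define safe where "safe A B a b \<longleftrightarrow> a \<in> A \<and> b \<in> B \<and> (\<forall>b'\<in>B. b' \<noteq> b \<longrightarrow> {a, b'} \<in> E) \<and>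
    (\<forall>a'\<in>A. a' \<noteq> a \<longrightarrow> {a', b} \<in> E)" for A B a b
  have safe_sym: "safe A B a b = safe B A b a" for A B a b
    unfolding safe_def by (auto simp: insert_commute)
  define F where "F = {{a, b} | a b. safe A B a b}"
  have partner: "\<exists>w. safe A B u w" if "nearly_complete V E A B" "u \<in> A" for A B u
    using nearly_complete_partner[OF that] that(2) unfolding safe_def by metis
  have respond: "\<exists>w. safe A B u w \<and> guards_move E {a, b} {u, w}"
    if nc: "nearly_complete V E A B" and s: "safe A B a b" and u: "u \<in> A" "u \<noteq> a" for A B a b u
  proof -
    obtain w where w: "safe A B u w" using partner[OF nc u(1)] by blast
    have ne: "a \<noteq> b" "u \<noteq> w"
      using nearly_completeD(2)[OF nc] s w unfolding safe_def by blast+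
    have "{a, w} \<in> E" using s w u unfolding safe_def by metis
    moreover have "{b, u} \<in> E" using s u unfolding safe_def by (metis insert_commute)
    ultimately have "guards_move E {a, b} {w, u}"
      using ne by (intro guards_move_pairI) auto
    then show ?thesis using w by (auto simp: insert_commute)
  qed
  note V = nearly_completeD(1,2)[OF nc]
  have dom: "dominating_set V E D" if "D \<in> F" for D
    using that V unfolding F_def safe_def dominating_set_def by (auto simp: insert_commute)
  have step: "\<exists>D'\<in>F. r \<in> D' \<and> guards_move E D D'" if D: "D \<in> F" and r: "r \<in> V - D" for D r
  proof -
    obtain a b where ab: "D = {a, b}" "safe A B a b" using D unfolding F_def by blast
    consider "r \<in> A" "r \<noteq> a" | "r \<in> B" "r \<noteq> b" using r V ab(1) by blast
    then show ?thesis
    proof cases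
      case 1
      then obtain w where w: "safe A B r w" "guards_move E {a, b} {r, w}"
        using respond[OF nc ab(2)] by blast
      then have "{r, w} \<in> F" unfolding F_def by blast
      then show ?thesis using w(2) ab(1) by blast
    next
      case 2
      then obtain w where w: "safe B A r w" "guards_move E {b, a} {r, w}"
        using respond[OF nearly_complete_sym[OF nc]] ab(2) safe_sym by blast
      then have "{w, r} \<in> F" using safe_sym unfolding F_def by blast
      then show ?thesis using w(2) ab(1) by (metis insert_commute insertI1)
    qed
  qed
  note cards = nearly_completeD(3,4)[OF nc]
  obtain a where "a \<in> A" using cards(1) by fastforce
  then obtain b where ab: "safe A B a b" using partner[OF nc] by blast
  then have "{a, b} \<in> F" unfolding F_def by blast
  then have "m_eternal_dominating_set V E {a, b}"
    using m_eternal_if_closed_family dom step by metis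
  moreover have "card {a, b} = 2" 
  proof -
    have "a \<noteq> b" using ab V(2) unfolding safe_def by blast
    then show ?thesis by simp
  qed
  moreover have "card D \<ge> 2" if "dominating_set V E D" for D
  proof (rule card_dominating_ge_2[OF \<open>finite V\<close> _ _ that])
    show "V \<noteq> {}" using \<open>a \<in> A\<close> V by blast
    fix v assume "v \<in> V"
    show "\<exists>u\<in>V. u \<noteq> v \<and> {u, v} \<notin> E"
    proof (cases "v \<in> A")
      case True
      obtain u where "u \<in> A" "u \<noteq> v" using obtains_other[OF cards(1)] by blast
      then show ?thesis using nearly_completeD(1,2,5)[OF nc] True by blast
    next
      case False
      obtain u where "u \<in> B" "u \<noteq> v" using obtains_other[OF cards(2)] by blast
      then show ?thesis using nearly_completeD(1,2,5)[OF nc] False \<open>v \<in> V\<close> by blast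
    qed
  qed
  ultimately show ?thesis by (rule both_numbers_eq_2)
qed

section \<open>Nearly complete bipartite graphs and the class\<close>

text \<open>Numbering both sides turns the non-edges between them into the deleted matching. Its
  size is at most the number of vertices of \<open>A\<close> with a non-neighbour in
  \<open>B\<close>, which is what the bounds of the class are checked against.\<close>

lemma nearly_complete_imp_class_C_le:
  assumes nc: "nearly_complete V E A B" and "finite V" and le: "card A \<le> card B"
  shows "class_C V E"
proof -
  define m n where "m = card A" and "n = card B"
  have V: "V = A \<union> B" "A \<inter> B = {}" and m: "2 \<le> m"
    and bip: "\<And>u v. {u, v} \<in> E \<Longrightarrow> u \<in> A \<and> v \<in> B \<or> u \<in> B \<and> v \<in> A"
    and uA: "\<And>a b b'. a \<in> A \<Longrightarrow> b \<in> B \<Longrightarrow> b' \<in> B \<Longrightarrow> {a, b} \<notin> E \<Longrightarrow> {a, b'} \<notin> E \<Longrightarrow> b = b'"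
    and uB: "\<And>a a' b. b \<in> B \<Longrightarrow> a \<in> A \<Longrightarrow> a' \<in> A \<Longrightarrow> {a, b} \<notin> E \<Longrightarrow> {a', b} \<notin> E \<Longrightarrow> a = a'"
    and full: "(\<exists>a\<in>A. \<forall>b\<in>B. {a, b} \<in> E) \<longleftrightarrow> (\<exists>b\<in>B. \<forall>a\<in>A. {a, b} \<in> E)"
    using nearly_completeD[OF nc] unfolding m_def by blast+
  have fin: "finite A" "finite B" using V \<open>finite V\<close> by auto
  obtain \<alpha> where \<alpha>: "bij_betw \<alpha> A {..<m}"
    using ex_bij_betw_finite_nat[OF fin(1)] by (auto simp: m_def atLeast0LessThan)
  obtain \<beta> where \<beta>: "bij_betw \<beta> B {..<n}"
    using ex_bij_betw_finite_nat[OF fin(2)] by (auto simp: n_def atLeast0LessThan)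
  have \<alpha>i: "\<alpha> a = \<alpha> a' \<longleftrightarrow> a = a'" if "a \<in> A" "a' \<in> A" for a a'
    using \<alpha> that by (auto simp: bij_betw_def inj_on_def)
  have \<beta>i: "\<beta> a = \<beta> a' \<longleftrightarrow> a = a'" if "a \<in> B" "a' \<in> B" for a a'
    using \<beta> that by (auto simp: bij_betw_def inj_on_def)
  have lt: "\<And>a. a \<in> A \<Longrightarrow> \<alpha> a < m" "\<And>b. b \<in> B \<Longrightarrow> \<beta> b < n"
    using \<alpha> \<beta> by (auto simp: bij_betw_def)
  define f where "f v = (if v \<in> A then Inl (\<alpha> v) else Inr (\<beta> v))" for v
  have fA: "f a = Inl (\<alpha> a)" if "a \<in> A" for a using that by (simp add: f_def)
  have fB: "f b = Inr (\<beta> b)" if "b \<in> B" for b using that V by (auto simp: f_def)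
  define M where "M = {{Inl (\<alpha> a), Inr (\<beta> b)} | a b. a \<in> A \<and> b \<in> B \<and> {a, b} \<notin> E}"
  have M_iff: "{Inl (\<alpha> a), Inr (\<beta> b)} \<in> M \<longleftrightarrow> {a, b} \<notin> E" if "a \<in> A" "b \<in> B" for a b
    unfolding M_def using that \<alpha>i \<beta>i by (auto simp: doubleton_eq_iff)
  have matching: "matching (complete_bipartite_edges m n) M"
    unfolding matching_def
  proof (intro conjI ballI impI)
    show "M \<subseteq> complete_bipartite_edges m n"
      unfolding M_def complete_bipartite_edges_def using lt by blast
    fix e e' assume "e \<in> M" "e' \<in> M" "e \<noteq> e'"
    then obtain a b a' b' where
      e: "e = {Inl (\<alpha> a), Inr (\<beta> b)}" "a \<in> A" "b \<in> B" "{a, b} \<notin> E" and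
      e': "e' = {Inl (\<alpha> a'), Inr (\<beta> b')}" "a' \<in> A" "b' \<in> B" "{a', b'} \<notin> E"
      unfolding M_def by blast
    have "a \<noteq> a'" "b \<noteq> b'" using \<open>e \<noteq> e'\<close> e e' uA uB by blast+
    then show "e \<inter> e' = {}" using e e' \<alpha>i \<beta>i by auto
  qed
  have bij: "bij_betw f V (complete_bipartite_verts m n)"
    unfolding bij_betw_def
  proof
    show "inj_on f V"
      unfolding inj_on_def f_def using V \<alpha>i \<beta>i by auto
    have "f ` V = Inl ` \<alpha> ` A \<union> Inr ` \<beta> ` B"
      unfolding V(1) image_Un image_image using fA fB by auto
    then show "f ` V = complete_bipartite_verts m n"
      using \<alpha> \<beta> by (auto simp: bij_betw_def complete_bipartite_verts_def Plus_def)
  qed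
  have cross: "{a, b} \<in> E \<longleftrightarrow> {f a, f b} \<in> complete_bipartite_edges m n - M"
    if "a \<in> A" "b \<in> B" for a b
    using that M_iff[OF that] lt fA fB unfolding complete_bipartite_edges_def by auto
  have "graph_iso V E (complete_bipartite_verts m n) (complete_bipartite_edges m n - M)"
    unfolding graph_iso_def
  proof (intro exI[of _ f] conjI ballI bij)
    fix u v assume uv: "u \<in> V" "v \<in> V"
    show "{u, v} \<in> E \<longleftrightarrow> {f u, f v} \<in> complete_bipartite_edges m n - M"
    proof -
      consider "u \<in> A" "v \<in> B" | "u \<in> B" "v \<in> A" | "u \<in> A" "v \<in> A" | "u \<in> B" "v \<in> B"
        using uv V by blast
      then show ?thesis
      proof cases
        case 1 then show ?thesis by (rule cross)
      next
        case 2 then show ?thesis using cross[of v u] by (simp add: insert_commute)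
      next
        case 3
        then have "{u, v} \<notin> E" using bip V(2) by blast
        then show ?thesis using 3 fA
          by (auto simp: complete_bipartite_edges_def doubleton_eq_iff)
      next
        case 4
        then have "{u, v} \<notin> E" using bip V(2) by blast
        then show ?thesis using 4 fB
          by (auto simp: complete_bipartite_edges_def doubleton_eq_iff)
      qed
    qed
  qed
  then have iso: "bipartite_minus_matching m n (card M) V E"
    using matching unfolding bipartite_minus_matching_def by blast
  define N where "N = {a\<in>A. \<exists>b\<in>B. {a, b} \<notin> E}"
  \<comment> \<open>For \<open>a\<close> in \<open>N\<close>, \<open>p a\<close> is its only
    non-neighbour in \<open>B\<close>, so a deleted edge is determined by its end in
    \<open>A\<close>.\<close>
  define p where "p a = (SOME b. b \<in> B \<and> {a, b} \<notin> E)" for a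
  have p: "p a \<in> B \<and> {a, p a} \<notin> E" if "a \<in> N" for a
    unfolding p_def by (rule someI_ex) (use that in \<open>auto simp: N_def\<close>)
  have "M \<subseteq> (\<lambda>a. {Inl (\<alpha> a), Inr (\<beta> (p a))}) ` N"
  proof
    fix e assume "e \<in> M"
    then obtain a b where e: "e = {Inl (\<alpha> a), Inr (\<beta> b)}" "a \<in> A" "b \<in> B" "{a, b} \<notin> E"
      unfolding M_def by blast
    then have "a \<in> N" unfolding N_def by blast
    moreover have "p a = b" using uA p[OF \<open>a \<in> N\<close>] e by blast
    ultimately show "e \<in> (\<lambda>a. {Inl (\<alpha> a), Inr (\<beta> (p a))}) ` N" using e(1) by blast
  qed
  moreover have "finite N" "N \<subseteq> A" using fin unfolding N_def by auto
  ultimately have MN: "card M \<le> card N" by (meson surj_card_le)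
  show ?thesis
  proof (cases "m = n")
    case True
    have "card M \<le> m" using MN card_mono[OF fin(1) \<open>N \<subseteq> A\<close>] by (simp add: m_def)
    then show ?thesis using iso m True unfolding class_C_def by blast
  next
    case False
    then have "m < n" using le by (simp add: m_def n_def)
    \<comment> \<open>If every vertex of \<open>A\<close> missed one of \<open>B\<close>, the last
      condition of \<open>nearly_complete\<close> would make every vertex of \<open>B\<close> a
      value of \<open>p\<close>, so \<open>B\<close> could not be the larger side.\<close>
    have "N \<noteq> A"
    proof
      assume "N = A"
      then have "B \<subseteq> p ` A" 
      proof -
        have "\<nexists>b. b \<in> B \<and> (\<forall>a\<in>A. {a, b} \<in> E)" using full \<open>N = A\<close> unfolding N_def by blast
        then show ?thesis using uA p \<open>N = A\<close> by (metis image_eqI subsetI)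
      qed
      then have "card B \<le> card A" using fin(1) by (meson surj_card_le)
      then show False using \<open>m < n\<close> by (simp add: m_def n_def)
    qed
    then have "card N < m" using \<open>N \<subseteq> A\<close> fin by (simp add: m_def psubset_card_mono psubsetI)
    then have "card M \<le> m - 1" using MN by simp
    then show ?thesis using iso m \<open>m < n\<close> unfolding class_C_def by blast
  qed
qed

lemma nearly_complete_imp_class_C:
  assumes "nearly_complete V E A B" and "finite V"
  shows "class_C V E"
  using nearly_complete_imp_class_C_le[OF assms] nearly_complete_imp_class_C_le[of V E B A]
    nearly_complete_sym[OF assms(1)] assms(2) by linarith

text \<open>Otherwise each vertex of \<open>B\<close> has a non-neighbour in \<open>A\<close>, and
  choosing one is injective because vertices of \<open>A\<close> miss at most one vertex. So
  \<open>B\<close> is not larger than \<open>A\<close>; for equal sizes the image would also have to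
  avoid the fully adjacent vertex of \<open>A\<close>.\<close>

lemma full_vertex_if_card:
  assumes fin: "finite A"
    and uA: "\<And>a b b'. a \<in> A \<Longrightarrow> b \<in> B \<Longrightarrow> b' \<in> B \<Longrightarrow> {a, b} \<notin> E \<Longrightarrow> {a, b'} \<notin> E \<Longrightarrow> b = b'"
    and card: "card A < card B \<or> card A = card B \<and> (\<exists>a\<in>A. \<forall>b\<in>B. {a, b} \<in> E)"
  shows "\<exists>b\<in>B. \<forall>a\<in>A. {a, b} \<in> E"
proof (rule ccontr)
  assume "\<not> ?thesis"
  then have "\<forall>b\<in>B. \<exists>a. a \<in> A \<and> {a, b} \<notin> E" by blast
  then obtain q where q: "\<And>b. b \<in> B \<Longrightarrow> q b \<in> A \<and> {q b, b} \<notin> E" by metis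
  have inj: "inj_on q B" using q uA unfolding inj_on_def by metis
  have "card B \<le> card A" using inj q fin by (meson card_inj_on_le image_subsetI)
  then obtain a where a: "card A = card B" "a \<in> A" "\<forall>b\<in>B. {a, b} \<in> E" using card by auto
  then have "q ` B \<subseteq> A - {a}" using q by blast
  then have "card B \<le> card (A - {a})" using inj fin by (meson card_inj_on_le finite_Diff)
  then show False using a fin by (metis card_Diff1_less not_less)
qed

text \<open>The sides are the preimages of the two summands, and disjointness of matching edges
  gives unique non-neighbours. The last condition is a count: for \<open>m = n\<close> a full vertex
  on one side forces one on the other, for \<open>m < n\<close> both sides have one.\<close>

lemma class_C_imp_nearly_complete:
  assumes "simple_graph V E" and "class_C V E"
  shows "\<exists>A B. nearly_complete V E A B"
proof -
  obtain m n k where iso: "bipartite_minus_matching m n k V E" and m: "2 \<le> m"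
    and sizes: "m = n \<or> m < n \<and> k \<le> m - 1"
    using assms(2) unfolding class_C_def by blast
  obtain M f where M: "matching (complete_bipartite_edges m n) M" "card M = k"
    and f: "bij_betw f V (complete_bipartite_verts m n)"
    and adj: "\<And>u v. u \<in> V \<Longrightarrow> v \<in> V \<Longrightarrow>
      {u, v} \<in> E \<longleftrightarrow> {f u, f v} \<in> complete_bipartite_edges m n - M"
    using iso unfolding bipartite_minus_matching_def graph_iso_def by blast
  have inV: "u \<in> V \<and> v \<in> V" if "{u, v} \<in> E" for u v
    using that assms(1) unfolding simple_graph_def by blast
  have "finite V" using assms(1) unfolding simple_graph_def by blast
  define A where "A = {v\<in>V. \<exists>i<m. f v = Inl i}"
  define B where "B = {v\<in>V. \<exists>j<n. f v = Inr j}"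
  have inj: "inj_on f V" using f by (simp add: bij_betw_def)
  have onto: "f ` V = Inl ` {..<m} \<union> Inr ` {..<n}"
    using f by (simp add: bij_betw_def complete_bipartite_verts_def Plus_def)
  have V: "V = A \<union> B" "A \<inter> B = {}"
  proof -
    have "v \<in> A \<union> B" if "v \<in> V" for v
    proof -
      have "f v \<in> Inl ` {..<m} \<union> Inr ` {..<n}" using that onto by blast
      then show ?thesis using that unfolding A_def B_def by blast
    qed
    then show "V = A \<union> B" unfolding A_def B_def by blast
    show "A \<inter> B = {}" unfolding A_def B_def by auto
  qed
  have "f ` A = Inl ` {..<m}"
  proof
    show "f ` A \<subseteq> Inl ` {..<m}" unfolding A_def by auto
    show "Inl ` {..<m} \<subseteq> f ` A"
    proof
      fix x :: "nat + nat" assume x: "x \<in> Inl ` {..<m}"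
      then obtain v where "v \<in> V" "x = f v" using onto by blast
      then show "x \<in> f ` A" using x unfolding A_def by blast
    qed
  qed
  moreover have "f ` B = Inr ` {..<n}"
  proof
    show "f ` B \<subseteq> Inr ` {..<n}" unfolding B_def by auto
    show "Inr ` {..<n} \<subseteq> f ` B"
    proof
      fix x :: "nat + nat" assume x: "x \<in> Inr ` {..<n}"
      then obtain v where "v \<in> V" "x = f v" using onto by blast
      then show "x \<in> f ` B" using x unfolding B_def by blast
    qed
  qed
  moreover have "card (f ` A) = card A" "card (f ` B) = card B"
    using inj V(1) by (auto intro!: card_image intro: inj_on_subset)
  ultimately have card: "card A = m" "card B = n"
    by (simp_all add: card_image)
  have cross: "{a, b} \<notin> E \<longleftrightarrow> {f a, f b} \<in> M" if "a \<in> A" "b \<in> B" for a b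
    using that adj[of a b] V unfolding A_def B_def complete_bipartite_edges_def by auto
  have disj: "\<And>e e'. e \<in> M \<Longrightarrow> e' \<in> M \<Longrightarrow> e \<inter> e' \<noteq> {} \<Longrightarrow> e = e'"
    using M(1) unfolding matching_def by blast
  have bip: "u \<in> A \<and> v \<in> B \<or> u \<in> B \<and> v \<in> A" if "{u, v} \<in> E" for u v
    using adj[of u v] inV[OF that] that unfolding A_def B_def complete_bipartite_edges_def
    by (auto simp: doubleton_eq_iff)
  have inj': "f u = f v \<longleftrightarrow> u = v" if "u \<in> V" "v \<in> V" for u v
    using inj that by (auto simp: inj_on_def)
  have uA: "b = b'" if "a \<in> A" "b \<in> B" "b' \<in> B" "{a, b} \<notin> E" "{a, b'} \<notin> E" for a b b'
  proof -
    have "{f a, f b} = {f a, f b'}" using that cross by (intro disj) auto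
    then show ?thesis using that inj' V by (auto simp: doubleton_eq_iff)
  qed
  have uB: "a = a'" if "b \<in> B" "a \<in> A" "a' \<in> A" "{a, b} \<notin> E" "{a', b} \<notin> E" for a a' b
  proof -
    have "{f a, f b} = {f a', f b}" using that cross by (intro disj) auto
    then show ?thesis using that inj' V by (auto simp: doubleton_eq_iff)
  qed
  have fin: "finite A" "finite B" using V \<open>finite V\<close> by auto
  have full: "(\<exists>a\<in>A. \<forall>b\<in>B. {a, b} \<in> E) \<longleftrightarrow> (\<exists>b\<in>B. \<forall>a\<in>A. {a, b} \<in> E)"
  proof (cases "m = n")
    case True
    \<comment> \<open>The counting lemma is applied with the sides exchanged, hence the reversed
      order inside the edge.\<close>
    have "\<exists>a\<in>A. \<forall>b\<in>B. {b, a} \<in> E" if "\<exists>b\<in>B. \<forall>a\<in>A. {a, b} \<in> E"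
      using that True card uB
      by (intro full_vertex_if_card[OF fin(2)]) (auto simp: insert_commute)
    moreover have "\<exists>b\<in>B. \<forall>a\<in>A. {a, b} \<in> E" if "\<exists>a\<in>A. \<forall>b\<in>B. {a, b} \<in> E"
      using that True card uA by (intro full_vertex_if_card[OF fin(1)]) auto
    ultimately show ?thesis by (auto simp: insert_commute)
  next
    case False
    then have mn: "m < n" "k \<le> m - 1" using sizes by auto
    have "\<exists>b\<in>B. \<forall>a\<in>A. {a, b} \<in> E"
      using mn card uA by (intro full_vertex_if_card[OF fin(1)]) auto
    moreover have "\<exists>a\<in>A. \<forall>b\<in>B. {a, b} \<in> E"
    proof (rule ccontr)
      assume "\<not> ?thesis"
      then have "\<forall>a\<in>A. \<exists>b. b \<in> B \<and> {f a, f b} \<in> M" using cross by blast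
      then obtain p where p: "\<And>a. a \<in> A \<Longrightarrow> p a \<in> B \<and> {f a, f (p a)} \<in> M" by metis
      \<comment> \<open>A matching edge at every vertex of \<open>A\<close> would give
        \<open>m\<close> different edges, too many for a matching of size at most
        \<open>m - 1\<close>. Edges at different vertices differ because each has just one end on
        the side of \<open>A\<close>.\<close>
      have "inj_on (\<lambda>a. {f a, f (p a)}) A"
      proof (rule inj_onI)
        fix a a' assume a: "a \<in> A" "a' \<in> A" "{f a, f (p a)} = {f a', f (p a')}"
        then have "f a = f a' \<or> f a = f (p a')" by (auto simp: doubleton_eq_iff)
        moreover have "a \<in> V" "a' \<in> V" "p a' \<in> V" "a \<noteq> p a'" using p a V by blast+
        ultimately show "a = a'" using inj' by blast
      qed
      moreover have "finite M"
      proof (rule finite_subset)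
        show "M \<subseteq> complete_bipartite_edges m n" using M(1) by (simp add: matching_def)
        show "finite (complete_bipartite_edges m n)"
          unfolding complete_bipartite_edges_def by (rule finite_image_set2) auto
      qed
      ultimately have "card A \<le> card M" using p by (intro card_inj_on_le) auto
      then show False using card M(2) mn m by simp
    qed
    ultimately show ?thesis by blast
  qed
  have "nearly_complete V E A B"
    using V card m sizes by (intro nearly_completeI bip uA uB full) auto
  then show ?thesis by blast
qed

section \<open>The five-cycle\<close>

lemma cycle_edges_5: "cycle_edges 5 = {{0, 1}, {1, 2}, {2, 3}, {3, 4}, {4, 0}}"
proof -
  have "cycle_edges 5 = (\<lambda>i. {i, (i + 1) mod 5}) ` {..<5}"
    unfolding cycle_edges_def by auto
  also have "{..<5::nat} = {0, 1, 2, 3, 4}" by auto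
  finally show ?thesis by (simp add: numeral_2_eq_2)
qed

text \<open>Absence of chords is not demanded: in a triangle-free graph it is automatic, so a
  spanning five-cycle already determines the graph. Naming the vertices in cyclic order makes
  rotation the only symmetry needed.\<close>

definition is_C5 :: "'a set \<Rightarrow> 'a set set \<Rightarrow> 'a \<Rightarrow> 'a \<Rightarrow> 'a \<Rightarrow> 'a \<Rightarrow> 'a \<Rightarrow> bool" where
  "is_C5 V E a b c d e \<longleftrightarrow> distinct [a, b, c, d, e] \<and> V = {a, b, c, d, e} \<and>
     {a, b} \<in> E \<and> {b, c} \<in> E \<and> {c, d} \<in> E \<and> {d, e} \<in> E \<and> {e, a} \<in> E"

lemma is_C5_rotate: "is_C5 V E a b c d e \<Longrightarrow> is_C5 V E b c d e a"
  unfolding is_C5_def by auto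

lemma is_C5_chord:
  assumes "triangle_free E" "is_C5 V E a b c d e"
  shows "{a, c} \<notin> E"
  using assms unfolding triangle_free_def is_C5_def by blast

lemma is_C5_imp_iso:
  assumes "simple_graph V E" "triangle_free E" and C: "is_C5 V E a b c d e"
  shows "graph_iso V E (cycle_verts 5) (cycle_edges 5)"
proof -
  have loop: "{v, v} \<notin> E" for v
    using assms(1) unfolding simple_graph_def by fastforce
  note C1 = is_C5_rotate[OF C]
  note C2 = is_C5_rotate[OF C1]
  note C3 = is_C5_rotate[OF C2]
  note C4 = is_C5_rotate[OF C3]
  have chords: "{a, c} \<notin> E" "{b, d} \<notin> E" "{c, e} \<notin> E" "{d, a} \<notin> E" "{e, b} \<notin> E"
    by (rule is_C5_chord[OF assms(2)], fact)+
  have verts: "cycle_verts 5 = {0, 1, 2, 3, 4}" unfolding cycle_verts_def by auto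
  \<comment> \<open>The default value 0 is the label of \<open>a\<close>.\<close>
  define f :: "'a \<Rightarrow> nat" where "f = (\<lambda>_. 0)(b := 1, c := 2, d := 3, e := 4)"
  have dist: "distinct [a, b, c, d, e]" and V: "V = {a, b, c, d, e}"
    using C unfolding is_C5_def by auto
  have f: "f a = 0" "f b = 1" "f c = 2" "f d = 3" "f e = 4"
    using dist unfolding f_def by auto
  have bij: "bij_betw f V (cycle_verts 5)"
    unfolding bij_betw_def inj_on_def V verts using f by simp
  have edges: "{a, b} \<in> E" "{b, c} \<in> E" "{c, d} \<in> E" "{d, e} \<in> E" "{e, a} \<in> E"
    using C unfolding is_C5_def by auto
  have edges': "{b, a} \<in> E" "{c, b} \<in> E" "{d, c} \<in> E" "{e, d} \<in> E" "{a, e} \<in> E"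
    using edges by (simp_all add: insert_commute)
  have chords': "{c, a} \<notin> E" "{d, b} \<notin> E" "{e, c} \<notin> E" "{a, d} \<notin> E" "{b, e} \<notin> E"
    using chords by (simp_all add: insert_commute)
  have "\<forall>u\<in>V. \<forall>v\<in>V. {u, v} \<in> E \<longleftrightarrow> {f u, f v} \<in> cycle_edges 5"
    unfolding V cycle_edges_5
    using f loop[of a] loop[of b] loop[of c] loop[of d] loop[of e] edges edges' chords chords'
    by (simp add: doubleton_eq_iff)
  then show ?thesis unfolding graph_iso_def using bij by blast
qed

lemma iso_imp_is_C5:
  assumes "graph_iso V E (cycle_verts 5) (cycle_edges 5)"
  obtains a b c d e where "is_C5 V E a b c d e"
proof -
  obtain f where bij: "bij_betw f V {..<5::nat}"
    and adj: "\<And>u v. u \<in> V \<Longrightarrow> v \<in> V \<Longrightarrow> {u, v} \<in> E \<longleftrightarrow> {f u, f v} \<in> cycle_edges 5"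
    using assms unfolding graph_iso_def cycle_verts_def by blast
  define h where "h = inv_into V f"
  have h: "bij_betw h {..<5} V" unfolding h_def using bij by (rule bij_betw_inv_into)
  have five: "{..<5::nat} = {0, 1, 2, 3, 4}" by auto
  have fh: "f (h i) = i" if "i < 5" for i
    unfolding h_def using bij_betw_inv_into_right[OF bij] that by blast
  have hV: "h i \<in> V" if "i < 5" for i
    using bij_betwE[OF h] that by blast
  have "V = h ` {..<5}" using h by (simp add: bij_betw_def)
  then have V: "V = {h 0, h 1, h 2, h 3, h 4}" unfolding five by simp
  have "distinct (map h [0, 1, 2, 3, 4])"
    using h unfolding bij_betw_def five by (simp add: distinct_map)
  then have "is_C5 V E (h 0) (h 1) (h 2) (h 3) (h 4)"
    unfolding is_C5_def using V by (simp add: cycle_edges_5 adj fh hV)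
  then show ?thesis by (rule that)
qed

text \<open>The pairs at distance two are a closed family. An attack between the guards makes both
  step in the same direction around the cycle; any other attack is answered by the adjacent guard
  alone.\<close>

lemma is_C5_numbers:
  assumes tf: "triangle_free E" and C: "is_C5 V E a b c d e"
  shows "domination_number V E = 2 \<and> m_eternal_domination_number V E = 2"
proof -
  define F where "F = {{u, w} | u v w x y. is_C5 V E u v w x y}"
  have FI: "{u, w} \<in> F" if "is_C5 V E u v w x y" for u v w x y
    using that unfolding F_def by blast
  have FE: "\<exists>u v w x y. D = {u, w} \<and> is_C5 V E u v w x y" if "D \<in> F" for D
    using that unfolding F_def by blast
  have dom: "dominating_set V E D" if "D \<in> F" for D
    using FE[OF that] unfolding is_C5_def dominating_set_def by (auto simp: insert_commute)
  have step: "\<exists>D'\<in>F. r \<in> D' \<and> guards_move E D D'" if D: "D \<in> F" and r: "r \<in> V - D" for D r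
  proof -
    obtain u v w x y where uw: "D = {u, w}" and C: "is_C5 V E u v w x y"
      using FE[OF D] by blast
    note C2 = is_C5_rotate[OF is_C5_rotate[OF C]]
    note C3 = is_C5_rotate[OF C2]
    note C4 = is_C5_rotate[OF C3]
    have edges: "{u, v} \<in> E" "{v, w} \<in> E" "{w, x} \<in> E" "{x, y} \<in> E" "{y, u} \<in> E"
      and dist: "distinct [u, v, w, x, y]" and V: "V = {u, v, w, x, y}"
      using C unfolding is_C5_def by auto
    consider "r = v" | "r = x" | "r = y" using r V uw by blast
    then show ?thesis
    proof cases
      case 1
      have "guards_move E {u, w} {y, v}"
        using edges dist by (intro guards_move_pairI) (auto simp: insert_commute)
      then show ?thesis using 1 uw FI[OF C4] by blast
    next
      case 2
      have "guards_move E {u, w} {u, x}"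
        using edges dist by (intro guards_move_pairI) (auto simp: insert_commute)
      then show ?thesis using 2 uw FI[OF C3] by (metis insert_commute insertI1)
    next
      case 3
      have "guards_move E {u, w} {y, w}"
        using edges dist by (intro guards_move_pairI) (auto simp: insert_commute)
      then show ?thesis using 3 uw FI[OF C2] by (metis insert_commute insertI1)
    qed
  qed
  have "m_eternal_dominating_set V E {a, c}"
    by (rule m_eternal_if_closed_family[of F]) (use dom step FI[OF C] in auto)
  moreover have "card {a, c} = 2" using C unfolding is_C5_def by simp
  moreover have "card D \<ge> 2" if "dominating_set V E D" for D
  proof (rule card_dominating_ge_2[OF _ _ _ that])
    show "finite V" "V \<noteq> {}" using C unfolding is_C5_def by auto
    fix v assume "v \<in> V"
    then have "v \<in> {a, b, c, d, e}" using C unfolding is_C5_def by simp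
    then obtain p q r s where v: "is_C5 V E v p q r s"
      using C is_C5_rotate[OF C] is_C5_rotate[OF is_C5_rotate[OF C]]
        is_C5_rotate[OF is_C5_rotate[OF is_C5_rotate[OF C]]]
        is_C5_rotate[OF is_C5_rotate[OF is_C5_rotate[OF is_C5_rotate[OF C]]]] by blast
    then show "\<exists>u\<in>V. u \<noteq> v \<and> {u, v} \<notin> E"
      using is_C5_chord[OF tf v] by (intro bexI[of _ q]) (auto simp: is_C5_def insert_commute)
  qed
  ultimately show ?thesis by (rule both_numbers_eq_2)
qed

section \<open>Graphs guarded by two guards\<close>

text \<open>These assumptions extract what the forward direction uses: a domination number above 1
  excludes a dominating vertex, and the value 2 of the eternal number provides a pair that can be
  defended.\<close>

locale two_guards =
  fixes V :: "'a set" and E :: "'a set set"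
  assumes simple: "simple_graph V E" and tf: "triangle_free E"
    and no_dominating_vertex: "v \<in> V \<Longrightarrow> \<exists>u\<in>V. u \<noteq> v \<and> {u, v} \<notin> E"
    and guardable: "\<exists>D. card D = 2 \<and> m_eternal_dominating_set V E D"
    and not_two_K1: "\<not> two_K1 V E" and not_K1_union_K2: "\<not> K1_union_K2 V E"
begin

definition adj :: "'a \<Rightarrow> 'a \<Rightarrow> bool" where
  "adj u v \<longleftrightarrow> {u, v} \<in> E"

definition eternal :: "'a \<Rightarrow> 'a \<Rightarrow> bool" where
  "eternal x y \<longleftrightarrow> x \<noteq> y \<and> m_eternal_dominating_set V E {x, y}"

lemma finite_V: "finite V"
  using simple by (simp add: simple_graph_def)

lemma adj_sym: "adj u v \<Longrightarrow> adj v u"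
  unfolding adj_def by (simp add: insert_commute)

lemma adj_irrefl: "\<not> adj v v"
  using simple unfolding adj_def simple_graph_def by fastforce

lemma adj_in_V: "adj u v \<Longrightarrow> u \<in> V \<and> v \<in> V"
  using simple unfolding adj_def simple_graph_def by blast

lemma no_triangle: "adj u v \<Longrightarrow> adj v w \<Longrightarrow> \<not> adj u w"
  using tf unfolding adj_def triangle_free_def by blast

lemma eternal_sym: "eternal x y \<Longrightarrow> eternal y x"
  unfolding eternal_def by (metis insert_commute)

lemma eternal_neq: "eternal x y \<Longrightarrow> x \<noteq> y"
  unfolding eternal_def by simp

lemma eternal_dom:
  assumes "eternal x y" "v \<in> V"
  shows "v = x \<or> v = y \<or> adj v x \<or> adj v y"
  using m_eternal_dominating[of V E "{x, y}"] assms
  unfolding eternal_def dominating_set_def adj_def by blast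

lemma eternal_in_V: "eternal x y \<Longrightarrow> x \<in> V \<and> y \<in> V"
  using m_eternal_dominating[of V E "{x, y}"] unfolding eternal_def dominating_set_def by blast

text \<open>The number of guards is preserved, so the answer is again a pair \<open>{r, z}\<close>.
  As \<open>r\<close> was unoccupied, one guard reaches it along an edge while the other stays or
  moves to \<open>z\<close>.\<close>

lemma eternal_step:
  assumes xy: "eternal x y" and r: "r \<in> V" "r \<noteq> x" "r \<noteq> y"
  shows "\<exists>z. eternal r z \<and>
    (adj x r \<and> (y = z \<or> adj y z) \<or> adj y r \<and> (x = z \<or> adj x z))"
proof -
  obtain D' where D': "r \<in> D'" "guards_move E {x, y} D'" "m_eternal_dominating_set V E D'"
    using m_eternal_step[of V E "{x, y}" r] xy r unfolding eternal_def by blast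
  have "card D' = card {x, y}"
    using D'(2) unfolding guards_move_def by (metis bij_betw_same_card)
  then have "card D' = 2" using eternal_neq[OF xy] by simp
  then obtain z where z: "D' = {r, z}" "r \<noteq> z"
    using D'(1) by (metis card_2_iff doubleton_eq_iff insertE singletonD)
  show ?thesis
    using guards_move_pairE[OF D'(2)[unfolded z(1)] eternal_neq[OF xy] z(2)] D'(3) z r
    unfolding eternal_def adj_def by blast
qed

lemma eternal_exists: "\<exists>x y. eternal x y"
  using guardable unfolding eternal_def by (metis card_2_iff)

text \<open>Attack \<open>v\<close>: the answer is an eternal pair containing it. Most
  contradictions below come from a partner \<open>w\<close> that would have to dominate too many
  vertices at once.\<close>

lemma eternal_partner:
  assumes "v \<in> V" shows "\<exists>w. eternal v w"
proof -
  obtain x y where xy: "eternal x y" using eternal_exists by blast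
  show ?thesis
  proof (cases "v = x \<or> v = y")
    case True
    then show ?thesis using xy eternal_sym by blast
  next
    case False
    then show ?thesis using eternal_step[OF xy assms] by blast
  qed
qed

lemma card_ge_2: "finite S \<Longrightarrow> u \<in> S \<Longrightarrow> v \<in> S \<Longrightarrow> u \<noteq> v \<Longrightarrow> 2 \<le> card S"
  using card_mono[of S "{u, v}"] by simp

lemma nearly_complete_adjI:
  assumes "V = A \<union> B" "A \<inter> B = {}" "2 \<le> card A" "2 \<le> card B"
    and "\<And>u v. adj u v \<Longrightarrow> u \<in> A \<and> v \<in> B \<or> u \<in> B \<and> v \<in> A"
    and "\<And>a b b'. a \<in> A \<Longrightarrow> b \<in> B \<Longrightarrow> b' \<in> B \<Longrightarrow> \<not> adj a b \<Longrightarrow> \<not> adj a b' \<Longrightarrow> b = b'"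
    and "\<And>a a' b. b \<in> B \<Longrightarrow> a \<in> A \<Longrightarrow> a' \<in> A \<Longrightarrow> \<not> adj a b \<Longrightarrow> \<not> adj a' b \<Longrightarrow> a = a'"
    and "(\<exists>a\<in>A. \<forall>b\<in>B. adj a b) \<longleftrightarrow> (\<exists>b\<in>B. \<forall>a\<in>A. adj a b)"
  shows "class_C V E"
proof -
  have "nearly_complete V E A B"
    using assms unfolding nearly_complete_def adj_def by (intro conjI allI ballI impI) metis+
  then show ?thesis using nearly_complete_imp_class_C finite_V by blast
qed

section \<open>An adjacent eternal pair\<close>

text \<open>Two vertices of \<open>N(x)\<close> missed by \<open>a\<close> would force \<open>N(y) = {a, x}\<close>, and then no pair containing
  one of them dominates the other one, \<open>a\<close> and \<open>y\<close>.\<close>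

lemma adjacent_pair_unique_nonneighbour:
  assumes xy: "eternal x y" "adj x y" and a: "adj a y"
    and b: "adj b x" "adj b' x" "\<not> adj a b" "\<not> adj a b'"
  shows "b = b'"
proof (rule ccontr)
  assume ne: "b \<noteq> b'"
  have inV: "a \<in> V" "b \<in> V" "b' \<in> V" "x \<in> V" "y \<in> V"
    using a b xy adj_in_V by blast+
  have ax: "a \<noteq> x" using b adj_sym by blast
  have nax: "\<not> adj a x" using a xy(2) adj_sym no_triangle by blast
  have ab: "a \<noteq> b" "a \<noteq> b'" using nax b by blast+
  have bb: "\<not> adj b b'" using b adj_sym no_triangle by blast
  have yb: "y \<noteq> b" "y \<noteq> b'" using a b by blast+
  have nyb: "\<not> adj y b" "\<not> adj y b'" using b(1,2) xy(2) adj_sym no_triangle by blast+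
  obtain z where z: "eternal a z" using eternal_partner inV(1) by blast
  have bz: "b = z \<or> adj b z" "b' = z \<or> adj b' z"
    using eternal_dom[OF z] inV ab b adj_sym by blast+
  have "adj b z" "adj b' z" using bz bb ne adj_sym by blast+
  then have zx: "\<not> adj z x" using b(1) no_triangle adj_sym by blast
  \<comment> \<open>The pair \<open>{a, z}\<close> must dominate \<open>x\<close>, which is adjacent
    to neither \<open>a\<close> nor \<open>z\<close>. Hence \<open>{a, x}\<close> dominates, and a
    further neighbour of \<open>y\<close> would form a triangle with \<open>y\<close> and one of
    them.\<close>
  then have "z = x" using eternal_dom[OF z inV(4)] ax nax adj_sym by blast
  then have Ny: "w = a \<or> w = x" if "adj w y" for w
    using eternal_dom[OF z, of w] that a xy(2) adj_in_V no_triangle adj_sym by blast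
  \<comment> \<open>Here \<open>w\<close> alone has to take care of \<open>b'\<close>,
    \<open>a\<close> and \<open>y\<close>. The last leaves only \<open>y\<close>, \<open>a\<close>
    and \<open>x\<close> as candidates, and each of these fails for \<open>a\<close> or
    \<open>b'\<close>.\<close>
  obtain w where w: "eternal b w" using eternal_partner inV(2) by blast
  have "b' = w \<or> adj b' w" using eternal_dom[OF w inV(3)] ne bb adj_sym by blast
  moreover have "a = w \<or> adj a w" using eternal_dom[OF w inV(1)] ab b adj_sym by blast
  moreover have "y = w \<or> adj y w" using eternal_dom[OF w inV(5)] yb nyb by blast
  ultimately show False using Ny nyb yb b ax nax adj_sym by blast
qed

text \<open>The sides are the neighbourhoods of \<open>y\<close> and of \<open>x\<close>. They cover
  all vertices by domination and are disjoint and independent by triangle-freeness; a non-neighbour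
  of \<open>x\<close> or of \<open>y\<close> provides the second vertex of a side.\<close>

lemma class_C_if_adjacent_pair:
  assumes xy: "eternal x y" and adj: "adj x y"
  shows "class_C V E"
proof (rule nearly_complete_adjI[of "{v \<in> V. adj v y}" "{v \<in> V. adj v x}"])
  have inV: "x \<in> V" "y \<in> V" using adj adj_in_V by blast+
  have cover: "adj v x \<or> adj v y" if "v \<in> V" for v
    using eternal_dom[OF xy that] adj adj_sym by blast
  show "V = {v \<in> V. adj v y} \<union> {v \<in> V. adj v x}" using cover by blast
  show "{v \<in> V. adj v y} \<inter> {v \<in> V. adj v x} = {}" using adj no_triangle adj_sym by blast
  obtain u where "u \<in> V" "u \<noteq> x" "\<not> adj u x"
    using no_dominating_vertex[OF inV(1)] unfolding adj_def by blast
  then show "2 \<le> card {v \<in> V. adj v y}"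
    using cover adj inV finite_V by (intro card_ge_2[of _ x u]) auto
  obtain u where "u \<in> V" "u \<noteq> y" "\<not> adj u y"
    using no_dominating_vertex[OF inV(2)] unfolding adj_def by blast
  then show "2 \<le> card {v \<in> V. adj v x}"
    using cover adj adj_sym inV finite_V by (intro card_ge_2[of _ y u]) auto
  show "u \<in> {v \<in> V. adj v y} \<and> v \<in> {v \<in> V. adj v x} \<or>
      u \<in> {v \<in> V. adj v x} \<and> v \<in> {v \<in> V. adj v y}" if "adj u v" for u v
    using that adj_in_V[OF that] cover[of u] cover[of v] no_triangle adj_sym by blast
  show "b = b'" if "a \<in> {v \<in> V. adj v y}" "b \<in> {v \<in> V. adj v x}" "b' \<in> {v \<in> V. adj v x}"
    "\<not> adj a b" "\<not> adj a b'" for a b b'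
    using adjacent_pair_unique_nonneighbour[OF xy adj] that by blast
  show "a = a'" if "b \<in> {v \<in> V. adj v x}" "a \<in> {v \<in> V. adj v y}" "a' \<in> {v \<in> V. adj v y}"
    "\<not> adj a b" "\<not> adj a' b" for a a' b
    using adjacent_pair_unique_nonneighbour[OF eternal_sym[OF xy] adj_sym[OF adj], of b a a']
      that adj_sym by blast
  \<comment> \<open>The witnesses are \<open>x\<close> here and \<open>y\<close> below: each is
    adjacent to the whole opposite side.\<close>
  have "\<exists>a\<in>{v \<in> V. adj v y}. \<forall>b\<in>{v \<in> V. adj v x}. adj a b"
    using adj inV adj_sym by blast
  moreover have "\<exists>b\<in>{v \<in> V. adj v x}. \<forall>a\<in>{v \<in> V. adj v y}. adj a b"
    using adj inV adj_sym by blast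
  ultimately show "(\<exists>a\<in>{v \<in> V. adj v y}. \<forall>b\<in>{v \<in> V. adj v x}. adj a b) \<longleftrightarrow>
    (\<exists>b\<in>{v \<in> V. adj v x}. \<forall>a\<in>{v \<in> V. adj v y}. adj a b)" by blast
qed

section \<open>Non-adjacent eternal pairs with a common neighbour\<close>

text \<open>The path \<open>x\<close>, \<open>c\<close>, \<open>y\<close>, \<open>z\<close> spans
  the graph and only the edge between \<open>x\<close> and \<open>z\<close> is undecided, so the
  graph is \<open>K\<^sub>2\<^sub>,\<^sub>2\<close> with at most one edge deleted.\<close>

lemma class_C_if_four_vertices:
  assumes V: "V = {x, y} \<union> {c, z}" and dist: "distinct [x, y, c, z]"
    and edges: "adj x c" "adj y c" "adj y z"
  shows "class_C V E"
proof (rule nearly_complete_adjI[OF V])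
  show "{x, y} \<inter> {c, z} = {}" "2 \<le> card {x, y}" "2 \<le> card {c, z}" using dist by auto
  have "\<not> adj x y" "\<not> adj c z" using edges no_triangle adj_sym by blast+
  then show "u \<in> {x, y} \<and> v \<in> {c, z} \<or> u \<in> {c, z} \<and> v \<in> {x, y}" if "adj u v" for u v
    using that adj_in_V[OF that] adj_irrefl adj_sym unfolding V by blast
qed (use edges in auto)

text \<open>The guards moved from \<open>{x, y}\<close> to \<open>{c, z}\<close>. A vertex outside
  these four is not adjacent to \<open>c\<close>, since \<open>{x, y}\<close> dominates it; then
  \<open>{c, z}\<close> forces it to be adjacent to \<open>z\<close>, hence not to \<open>y\<close>,
  hence to \<open>x\<close>. At most one such vertex exists, and it closes a five-cycle.\<close>

lemma common_neighbour_cases: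
  assumes xy: "eternal x y" "\<not> adj x y" and c: "adj x c" "adj y c"
    and cz: "eternal c z" "\<not> adj c z" and yz: "adj y z"
  shows "graph_iso V E (cycle_verts 5) (cycle_edges 5) \<or> class_C V E"
proof -
  have inV: "x \<in> V" "y \<in> V" "c \<in> V" "z \<in> V" using c yz adj_in_V by blast+
  have zx: "z \<noteq> x" using yz xy(2) adj_sym by blast
  then have dist: "distinct [x, y, c, z]"
    using eternal_neq[OF xy(1)] eternal_neq[OF cz(1)] c yz adj_irrefl by auto
  have other: "adj v z \<and> adj v x \<and> \<not> adj z x \<and> \<not> adj v y \<and> \<not> adj v c"
    if "v \<in> V" "v \<notin> {x, y, c, z}" for v
  proof -
    have "adj v x \<or> adj v y" using eternal_dom[OF xy(1) that(1)] that(2) by blast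
    then have vc: "\<not> adj v c" using c no_triangle by blast
    then have vz: "adj v z" using eternal_dom[OF cz(1) that(1)] that(2) by blast
    then have vy: "\<not> adj v y" using yz no_triangle adj_sym by blast
    then have "adj v x" using \<open>adj v x \<or> adj v y\<close> by blast
    then show ?thesis using vc vz vy no_triangle adj_sym by blast
  qed
  show ?thesis
  proof (cases "V \<subseteq> {x, y, c, z}")
    case True
    then have "V = {x, y} \<union> {c, z}" using inV by blast
    then show ?thesis using class_C_if_four_vertices dist c yz by blast
  next
    case False
    then obtain p where p: "p \<in> V" "p \<notin> {x, y, c, z}" by blast
    \<comment> \<open>Two such vertices are not adjacent, so a partner of \<open>p\<close> has to
      serve \<open>p'\<close>, \<open>c\<close> and \<open>y\<close>. But \<open>p'\<close> is
      adjacent to neither \<open>c\<close> nor \<open>y\<close>, and these two have no common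
      neighbour.\<close>
    have unique: "p' = p" if p': "p' \<in> V" "p' \<notin> {x, y, c, z}" for p'
    proof (rule ccontr)
      assume ne: "p' \<noteq> p"
      note p_other = other[OF p] and p'_other = other[OF p']
      have pp: "\<not> adj p' p" using p_other p'_other no_triangle adj_sym by blast
      obtain w where w: "eternal p w" using eternal_partner p(1) by blast
      have "p' = w \<or> adj p' w" using eternal_dom[OF w p'(1)] ne pp by blast
      moreover have "c = w \<or> adj c w"
        using eternal_dom[OF w inV(3)] p(2) p_other adj_sym by blast
      moreover have "y = w \<or> adj y w"
        using eternal_dom[OF w inV(2)] p(2) p_other adj_sym by blast
      ultimately show False
        using p'_other p'(2) c(2) no_triangle adj_sym by blast
    qed
    have "V = {x, p, z, y, c}" using unique p inV by blast
    then have "is_C5 V E x p z y c"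
      using dist p(2) other[OF p] c yz adj_sym unfolding is_C5_def adj_def by auto
    then show ?thesis using is_C5_imp_iso[OF simple tf] by blast
  qed
qed

text \<open>After an attack on \<open>c\<close> the guard that does not go to \<open>c\<close>
  cannot stay put, as it would form an adjacent eternal pair with \<open>c\<close>. So it moves
  along an edge to \<open>z\<close>; the two cases differ by exchanging \<open>x\<close> and
  \<open>y\<close>.\<close>

lemma common_neighbour:
  assumes nonadj: "\<And>x y. eternal x y \<Longrightarrow> \<not> adj x y"
    and xy: "eternal x y" and c: "adj x c" "adj y c"
  shows "graph_iso V E (cycle_verts 5) (cycle_edges 5) \<or> class_C V E"
proof -
  have "c \<in> V" "c \<noteq> x" "c \<noteq> y" using c adj_in_V adj_irrefl by blast+
  then obtain z where z: "eternal c z"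
    "adj x c \<and> (y = z \<or> adj y z) \<or> adj y c \<and> (x = z \<or> adj x z)"
    using eternal_step[OF xy] by blast
  have cz: "\<not> adj c z" using nonadj[OF z(1)] .
  then consider "adj y z" | "adj x z" using z(2) c adj_sym by blast
  then show ?thesis
  proof cases
    case 1
    then show ?thesis using common_neighbour_cases[OF xy nonadj[OF xy] c z(1) cz] by blast
  next
    case 2
    have yx: "eternal y x" using eternal_sym[OF xy] .
    then show ?thesis using common_neighbour_cases[OF yx nonadj[OF yx] c(2,1) z(1) cz 2] by blast
  qed
qed

end

section \<open>Eternal pairs without common neighbours\<close>

text \<open>In the remaining case every eternal pair \<open>{x, y}\<close> is non-adjacent and its neighbourhoods
  partition the other vertices, so partners are unique non-neighbours across the bipartition.\<close>

locale two_guards_partition = two_guards +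
  assumes nonadj: "eternal x y \<Longrightarrow> \<not> adj x y"
    and no_common: "eternal x y \<Longrightarrow> adj x c \<Longrightarrow> \<not> adj y c"
begin

text \<open>The pairs \<open>{x, y}\<close> and \<open>{v, x}\<close> together force the edge
  between \<open>v\<close> and \<open>y\<close> to be a component and all other vertices to be
  neighbours of \<open>x\<close>. At most one such vertex exists: none gives the excluded
  \<open>K1_union_K2\<close>, one gives two disjoint edges, which is
  \<open>K\<^sub>2\<^sub>,\<^sub>2\<close> minus a perfect matching.\<close>

lemma class_C_if_two_partners:
  assumes xy: "eternal x y" and vy: "adj v y" and vx: "eternal v x"
  shows "class_C V E"
proof -
  have inV: "x \<in> V" "y \<in> V" "v \<in> V" using eternal_in_V xy vx by blast+
  have ne: "x \<noteq> y" "v \<noteq> x" "v \<noteq> y" using xy vx eternal_neq vy adj_irrefl by blast+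
  have nxy: "\<not> adj x y" "\<not> adj v x" using nonadj xy vx by blast+
  have Ny: "u = v" if u: "adj u y" for u
  proof (rule ccontr)
    assume "u \<noteq> v"
    have "\<not> adj u v" using u vy no_triangle adj_sym by blast
    moreover have "\<not> adj u x" using no_common[OF xy, of u] u adj_sym by blast
    moreover have "u \<noteq> x" using u nxy by blast
    ultimately show False using eternal_dom[OF vx, of u] \<open>u \<noteq> v\<close> adj_in_V[OF u] by blast
  qed
  have Nv: "u = y" if u: "adj u v" for u
  proof (rule ccontr)
    assume "u \<noteq> y"
    have "u \<noteq> x" using u nxy adj_sym by blast
    moreover have "\<not> adj u y" using u vy no_triangle by blast
    ultimately have "adj u x" using eternal_dom[OF xy, of u] \<open>u \<noteq> y\<close> adj_in_V[OF u] by blast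
    then show False using no_common[OF vx, of u] u adj_sym by blast
  qed
  have other: "adj u x \<and> \<not> adj u y \<and> \<not> adj u v" if "u \<in> V" "u \<notin> {x, y, v}" for u
    using eternal_dom[OF xy that(1)] that(2) Ny Nv by blast
  have unique: "p' = p" if p: "p \<in> V" "p \<notin> {x, y, v}" and p': "p' \<in> V" "p' \<notin> {x, y, v}" for p p'
  proof (rule ccontr)
    assume ne: "p' \<noteq> p"
    note p_other = other[OF p] and p'_other = other[OF p']
    have pp: "\<not> adj p' p" using p_other p'_other no_triangle adj_sym by blast
    obtain w where w: "eternal p w" using eternal_partner p(1) by blast
    have "p' = w \<or> adj p' w" using eternal_dom[OF w p'(1)] ne pp by blast
    moreover have "y = w \<or> adj y w"
      using eternal_dom[OF w inV(2)] p(2) p_other adj_sym by blast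
    ultimately show False using Ny p'_other p'(2) adj_sym by blast
  qed
  show ?thesis
  proof (cases "V \<subseteq> {x, y, v}")
    case True
    then have V: "V = {x, y, v}" using inV by blast
    define f :: "'a \<Rightarrow> nat" where "f = (\<lambda>_. 0)(y := 1, v := 2)"
    have f: "f x = 0" "f y = 1" "f v = 2" using ne by (simp_all add: f_def)
    have "bij_betw f V {0, 1, 2}"
      unfolding bij_betw_def inj_on_def V using f by auto
    moreover have "\<forall>u\<in>V. \<forall>w\<in>V. adj u w \<longleftrightarrow> {f u, f w} \<in> {{1, 2}}"
      unfolding V using f vy nxy adj_sym adj_irrefl by (auto simp: doubleton_eq_iff)
    ultimately have "K1_union_K2 V E"
      unfolding K1_union_K2_def graph_iso_def adj_def by blast
    then show ?thesis using not_K1_union_K2 by blast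
  next
    case False
    then obtain p where p: "p \<in> V" "p \<notin> {x, y, v}" by blast
    note p_other = other[OF p]
    have V: "V = {x, v} \<union> {y, p}" using inV p unique by blast
    show ?thesis
    proof (rule nearly_complete_adjI[OF V])
      show "{x, v} \<inter> {y, p} = {}" "2 \<le> card {x, v}" "2 \<le> card {y, p}"
        using ne p(2) by auto
      show "u \<in> {x, v} \<and> w \<in> {y, p} \<or> u \<in> {y, p} \<and> w \<in> {x, v}" if "adj u w" for u w
        using that adj_in_V[OF that] adj_irrefl adj_sym nxy p_other unfolding V by blast
      show "(\<exists>a\<in>{x, v}. \<forall>b\<in>{y, p}. adj a b) = (\<exists>b\<in>{y, p}. \<forall>a\<in>{x, v}. adj a b)"
        using nxy p_other adj_sym by blast
    qed (use vy p_other adj_sym in auto)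
  qed
qed

text \<open>The vertex \<open>w\<close> is an eternal partner of \<open>v\<close>. Excluding
  \<open>x\<close> and \<open>y\<close> as partners puts \<open>w\<close> into the neighbourhood of
  \<open>x\<close>; the other vertices on the side of \<open>w\<close> are not adjacent to
  \<open>w\<close>, so domination by \<open>{v, w}\<close> makes them adjacent to
  \<open>v\<close>.\<close>

lemma unique_nonneighbour:
  assumes xy: "eternal x y" and vy: "adj v y" and not_C: "\<not> class_C V E"
  shows "\<exists>w. adj w x \<and> \<not> adj v w \<and> (\<forall>b. b = y \<or> adj b x \<longrightarrow> b \<noteq> w \<longrightarrow> adj v b)"
proof -
  obtain w where w: "eternal v w" using eternal_partner vy adj_in_V by blast
  have "w \<noteq> x" using class_C_if_two_partners[OF xy vy] w not_C by blast
  moreover have "w \<noteq> y" using nonadj[OF w] vy by blast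
  moreover have nwy: "\<not> adj w y" using no_common[OF w vy] .
  ultimately have wx: "adj w x" using eternal_dom[OF xy] eternal_in_V[OF w] by blast
  have "adj v b" if b: "b = y \<or> adj b x" "b \<noteq> w" for b
  proof -
    have "b \<in> V" using b(1) eternal_in_V[OF xy] adj_in_V by blast
    moreover have "\<not> adj b w" using b(1) nwy wx adj_sym no_triangle by blast
    moreover have "b \<noteq> v" using b(1) vy adj_irrefl no_common[OF xy, of v] adj_sym by blast
    ultimately show ?thesis using eternal_dom[OF w] b(2) adj_sym by blast
  qed
  then show ?thesis using wx nonadj[OF w] by blast
qed

lemma class_C: "class_C V E"
proof (rule ccontr)
  assume not_C: "\<not> class_C V E"
  obtain x y where xy: "eternal x y" using eternal_exists by blast
  have inV: "x \<in> V" "y \<in> V" using eternal_in_V[OF xy] by blast+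
  have nxy: "\<not> adj x y" "\<not> adj y x" "x \<noteq> y" using nonadj[OF xy] adj_sym eternal_neq[OF xy] by blast+
  define A where "A = insert x {v \<in> V. adj v y}"
  define B where "B = insert y {v \<in> V. adj v x}"
  have A: "\<exists>w. w \<in> B \<and> \<not> adj v w \<and> (\<forall>b\<in>B. b \<noteq> w \<longrightarrow> adj v b)" if v: "v \<in> A" for v
  proof (cases "v = x")
    case True
    then show ?thesis using nxy adj_sym unfolding B_def by blast
  next
    case False
    then show ?thesis
      using unique_nonneighbour[OF xy _ not_C, of v] v adj_in_V unfolding A_def B_def by blast
  qed
  have B: "\<exists>w. w \<in> A \<and> \<not> adj v w \<and> (\<forall>a\<in>A. a \<noteq> w \<longrightarrow> adj v a)" if v: "v \<in> B" for v
  proof (cases "v = y")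
    case True
    then show ?thesis using nxy adj_sym unfolding A_def by blast
  next
    case False
    then show ?thesis
      using unique_nonneighbour[OF eternal_sym[OF xy] _ not_C, of v] v adj_in_V
      unfolding A_def B_def by blast
  qed
  have V: "V = A \<union> B" using eternal_dom[OF xy] inV unfolding A_def B_def by blast
  have no_both: "\<not> (adj u x \<and> adj u y)" for u
    using no_common[OF xy, of u] adj_sym by blast
  have disj: "A \<inter> B = {}"
    using no_both nxy adj_irrefl unfolding A_def B_def by blast
  \<comment> \<open>If both neighbourhoods were empty, the graph would be the excluded
    \<open>two_K1\<close>. A neighbour of one of \<open>x\<close>, \<open>y\<close> yields a
    neighbour of the other through \<open>unique_nonneighbour\<close>.\<close>
  have nonempty: "\<exists>u. adj u y" "\<exists>u. adj u x"
  proof -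
    have "(\<exists>u. adj u y) \<or> (\<exists>u. adj u x)"
    proof (rule ccontr)
      assume "\<not> ?thesis"
      then have V2: "V = {x, y}" and "\<And>u. \<not> adj u x" "\<And>u. \<not> adj u y"
        using V unfolding A_def B_def by blast+
      then have "\<forall>u\<in>V. \<forall>v\<in>V. \<not> adj u v" by blast
      moreover have "bij_betw ((\<lambda>_. 0)(y := 1)) V {0, 1 :: nat}"
        unfolding bij_betw_def inj_on_def V2 using nxy by auto
      ultimately have "two_K1 V E"
        unfolding two_K1_def graph_iso_def adj_def by blast
      then show False using not_two_K1 by blast
    qed
    then show "\<exists>u. adj u y" "\<exists>u. adj u x"
      using unique_nonneighbour[OF xy _ not_C]
        unique_nonneighbour[OF eternal_sym[OF xy] _ not_C] by blast+
  qed
  have "class_C V E"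
  proof (rule nearly_complete_adjI[OF V disj])
    have fin: "finite A" "finite B" using V finite_V by auto
    obtain u where "adj u y" using nonempty by blast
    then show "2 \<le> card A"
      using fin nxy adj_in_V unfolding A_def by (intro card_ge_2[of _ x u]) auto
    obtain u where "adj u x" using nonempty by blast
    then show "2 \<le> card B"
      using fin nxy adj_in_V unfolding B_def by (intro card_ge_2[of _ y u]) auto
    have "\<not> adj u v" if "u \<in> A" "v \<in> A" for u v
      using that no_both[of u] no_both[of v] no_triangle[of u y v] adj_sym[of u v] adj_sym[of v y]
        adj_irrefl unfolding A_def by blast
    moreover have "\<not> adj u v" if "u \<in> B" "v \<in> B" for u v
      using that no_both[of u] no_both[of v] no_triangle[of u x v] adj_sym[of u v] adj_sym[of v x]
        adj_irrefl unfolding B_def by blast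
    ultimately show "u \<in> A \<and> v \<in> B \<or> u \<in> B \<and> v \<in> A" if "adj u v" for u v
      using that adj_in_V[OF that] V by blast
    show "b = b'" if "a \<in> A" "b \<in> B" "b' \<in> B" "\<not> adj a b" "\<not> adj a b'" for a b b'
      using A[OF that(1)] that by metis
    show "a = a'" if "b \<in> B" "a \<in> A" "a' \<in> A" "\<not> adj a b" "\<not> adj a' b" for a a' b
      using B[OF that(1)] that adj_sym by metis
    \<comment> \<open>Every vertex misses exactly one on the other side, so neither side has a fully
      adjacent vertex and the deleted matching is perfect.\<close>
    have "\<not> (\<exists>a\<in>A. \<forall>b\<in>B. adj a b)" using A by metis
    moreover have "\<not> (\<exists>b\<in>B. \<forall>a\<in>A. adj a b)" using B adj_sym by metis
    ultimately show "(\<exists>a\<in>A. \<forall>b\<in>B. adj a b) \<longleftrightarrow> (\<exists>b\<in>B. \<forall>a\<in>A. adj a b)" by blast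
  qed
  then show False using not_C by blast
qed

end

section \<open>Combination of the cases\<close>

lemma (in two_guards) C5_or_class_C:
  "graph_iso V E (cycle_verts 5) (cycle_edges 5) \<or> class_C V E"
proof (cases "\<forall>x y. eternal x y \<longrightarrow> \<not> adj x y")
  case False
  then show ?thesis using class_C_if_adjacent_pair by blast
next
  case True
  then have nonadj: "\<And>x y. eternal x y \<Longrightarrow> \<not> adj x y" by blast
  show ?thesis
  proof (cases "\<exists>x y c. eternal x y \<and> adj x c \<and> adj y c")
    case True
    then show ?thesis using common_neighbour[OF nonadj] by blast
  next
    case False
    then interpret two_guards_partition V E
      using nonadj by unfold_locales blast+
    show ?thesis using class_C by blast
  qed
qed

lemma numbers_2_imp_two_guards:
  assumes "simple_graph V E" "triangle_free E" "\<not> two_K1 V E" "\<not> K1_union_K2 V E"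
    and dom: "domination_number V E = 2" and eternal: "m_eternal_domination_number V E = 2"
  shows "two_guards V E"
proof
  show "\<exists>u\<in>V. u \<noteq> v \<and> {u, v} \<notin> E" if "v \<in> V" for v
  proof (rule ccontr)
    assume "\<not> ?thesis"
    then have "dominating_set V E {v}" using that unfolding dominating_set_def by blast
    then have "domination_number V E \<le> card {v}"
      unfolding domination_number_def by (intro Least_le) blast
    then show False using dom by simp
  qed
  \<comment> \<open>Without a witness the value of \<open>LEAST\<close> would say nothing; with one,
    the minimum 2 is attained by an actual set.\<close>
  have "\<exists>k D. m_eternal_dominating_set V E D \<and> card D = k" using m_eternal_UNIV by blast
  from LeastI_ex[OF this] show "\<exists>D. card D = 2 \<and> m_eternal_dominating_set V E D"
    using eternal unfolding m_eternal_domination_number_def by auto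
qed fact+

theorem corollary4p4:
  fixes V :: "'a set" and E :: "'a set set"
  assumes "simple_graph V E"
    and "triangle_free E"
    and "\<not> two_K1 V E"
    and "\<not> K1_union_K2 V E"
  shows "(domination_number V E = 2 \<and> m_eternal_domination_number V E = 2) \<longleftrightarrow>
         (graph_iso V E (cycle_verts 5) (cycle_edges 5) \<or> class_C V E)"
proof
  assume "domination_number V E = 2 \<and> m_eternal_domination_number V E = 2"
  then interpret two_guards V E
    using numbers_2_imp_two_guards[OF assms] by blast
  show "graph_iso V E (cycle_verts 5) (cycle_edges 5) \<or> class_C V E"
    by (rule C5_or_class_C)
next
  assume "graph_iso V E (cycle_verts 5) (cycle_edges 5) \<or> class_C V E"
  then show "domination_number V E = 2 \<and> m_eternal_domination_number V E = 2"
  proof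
    assume "graph_iso V E (cycle_verts 5) (cycle_edges 5)"
    then show ?thesis using iso_imp_is_C5 is_C5_numbers[OF assms(2)] by metis
  next
    assume "class_C V E"
    moreover have "finite V" using assms(1) by (simp add: simple_graph_def)
    ultimately show ?thesis
      using class_C_imp_nearly_complete[OF assms(1)] nearly_complete_numbers by blast
  qed
qed

end
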